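(* Let $w_0$ be an arbitrary (complex) number, let $(c_n)_{n\ge 1}$ and $(a_{n,j})_{n\ge 1,\ 0\le j\le n-1}$ be arbitrary families of (complex) numbers, and let the sequence $(w_n)_{n\ge 1}$ be defined recursively by $$w_n = c_n + \sum_{j=0}^{n-1} a_{n,j}\, w_j \qquad (n\ge 1).$$ For an integer $n\ge 1$ and a function $f=f_{x,y}$ of two integer variables, defined for $x>y\ge 0$, put $$\Phi_n f_{x,y} := \sum_{j=1}^{2^n}\ \prod_{k=0}^{n-1}\Bigl(1+\beta_k(j)\,\bigl(f_{k+1,\ \lceil \log_2(1+((j-1)\bmod 2^k))\rceil}-1\bigr)\Bigr),$$ where $\beta_k(j)\in\{0,1\}$ is the $j$-th term ($j\ge 1$) of the periodic sequence consisting of $2^k$ zeros followed by $2^k$ ones, repeated; that is, $\beta_k(j)=\lfloor (j-1)/2^k\rfloor \bmod 2$. Then $$\Phi_n f_{x,y} = 1+\sum_{m=1}^{n}\ \sum_{1\le k_1<\cdots<k_m\le n} f_{k_1,0}\prod_{i=2}^{m} f_{k_i,k_{i-1}},$$ and for every integer $n\ge 1$, $$\sum_{j=0}^{n} w_j = c_n + w_0\,\Phi_n a_{x,y} + \sum_{\ell=1}^{n-1} c_\ell\,\Phi_{n-\ell}\, a_{x+\ell,\,y+\ell}.$$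
   Context: The coefficients $a_{n,j}$ are regarded as the values of a function $a_{x,y}$ of two integer variables at $x=n$, $y=j$. The operator $\Phi_n=\Phi_{n;x,y}$ sends a function of the two variables $x,y$ to a number. In $\Phi_{n-\ell}\,a_{x+\ell,y+\ell}$ the operator $\Phi_{n-\ell}$ is applied to the shifted function $f_{x,y}=a_{x+\ell,y+\ell}$, i.e. $f_{p,q}=a_{p+\ell,q+\ell}$. Empty products equal $1$ and empty sums equal $0$. *)

theory Defs
  imports Complex_Main
begin

definition beta :: "nat \<Rightarrow> nat \<Rightarrow> nat" where
  "beta k j = ((j - 1) div 2 ^ k) mod 2"

(* Functions of two integer variables defined for x > y \<ge> 0 are represented by total functions on
   nat. For j \<ge> 1 the second index below lies in {0..k}, so only values f x y with x > y occur;
   the ceiling is nonnegative, so the conversion to nat does not truncate. *)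
definition Phi :: "nat \<Rightarrow> (nat \<Rightarrow> nat \<Rightarrow> complex) \<Rightarrow> complex" where
  "Phi n f = (\<Sum>j = 1..2 ^ n. \<Prod>k<n.
     1 + of_nat (beta k j) * (f (k + 1) (nat \<lceil>log 2 (1 + real ((j - 1) mod 2 ^ k))\<rceil>) - 1))"

(* A tuple k_1 < ... < k_m in {1..n} is the list ks with k_i = ks ! (i - 1). *)
definition increasing_tuples :: "nat \<Rightarrow> nat \<Rightarrow> nat list set" where
  "increasing_tuples m n = {ks. length ks = m \<and> sorted_wrt (<) ks \<and> set ks \<subseteq> {1..n}}"

end

theory Submission
  imports Defs
begin

text \<open>
  Everything is governed by the solution \<open>path_sum f\<close> of the homogeneous recursion
  \<open>p 0 = 1\<close>, \<open>p (n + 1) = (\<Sum>i\<le>n. f (n + 1) i * p i)\<close>. Unfolding this recursion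
  shows that \<open>p n\<close> sums the products of \<open>f\<close> along all chains \<open>0 < k\<^sub>1 < \<dots> < k\<^sub>m = n\<close>.

  The expansion of \<open>Phi n f\<close> amounts to the bijection between the numbers \<open>J = j - 1\<close> below
  \<open>2 ^ n\<close> and the subsets of \<open>{1..n}\<close>: \<open>k + 1\<close> belongs to the subset iff the bit
  \<open>k\<close> of \<open>J\<close> is set, and \<open>\<lceil>log 2 (1 + J mod 2 ^ k)\<rceil>\<close>, the binary length of the
  lower part of \<open>J\<close>, is the predecessor of \<open>k + 1\<close> in the subset (or 0). Instead of
  constructing the bijection, both sums are weighted by \<open>g\<close> of the largest element of the
  subset, and each is seen to obey the same recursion in \<open>n\<close>: a subset of \<open>{1..n + 1}\<close>
  either omits \<open>n + 1\<close>, or arises from a subset of \<open>{1..n}\<close>, whose largest element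
  then enters as the second argument of \<open>f (n + 1)\<close>. By \<open>weighted_path_sum_unique\<close> both
  equal \<open>\<Sum>i\<le>n. g i * path_sum f i\<close>; the choice \<open>g = 1\<close> gives the expansion and also
  \<open>Phi n f = (\<Sum>i\<le>n. path_sum f i)\<close>.

  For the sum of the \<open>w j\<close>, regard \<open>w 0\<close> as the inhomogeneity at index 0. By linearity
  \<open>w n\<close> is the superposition of the responses to the single inhomogeneities, and the
  response to \<open>c l\<close> is the homogeneous solution started at \<open>l\<close>, that is
  \<open>path_sum\<close> of the shifted coefficients at \<open>n - l\<close>. Summing over \<open>n\<close> turns each
  \<open>path_sum\<close> into a value of \<open>Phi\<close>; the term \<open>l = n\<close> is \<open>c n\<close> because \<open>Phi 0 f = 1\<close>.
\<close>

section \<open>Sums over chains\<close>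

fun path_sum :: "(nat \<Rightarrow> nat \<Rightarrow> 'a::comm_ring_1) \<Rightarrow> nat \<Rightarrow> 'a" where
  "path_sum f 0 = 1"
| "path_sum f (Suc n) = (\<Sum>i\<le>n. f (Suc n) i * path_sum f i)"

text \<open>
  \<open>F n g\<close> stands for a sum over the subsets of \<open>{1..n}\<close> in which a subset with largest
  element \<open>i\<close> (0 if empty) carries the extra factor \<open>g i\<close>. The weight has to be arbitrary,
  since in the step it is replaced by \<open>f (n + 1)\<close>.
\<close>

lemma weighted_path_sum_unique:
  fixes F :: "nat \<Rightarrow> (nat \<Rightarrow> 'a::comm_ring_1) \<Rightarrow> 'a"
  assumes zero: "\<And>g. F 0 g = g 0"
    and step: "\<And>n g. F (Suc n) g = F n g + g (Suc n) * F n (f (Suc n))"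
  shows "F n g = (\<Sum>i\<le>n. g i * path_sum f i)"
  by (induction n arbitrary: g) (simp_all add: zero step)

section \<open>Binary expansion of Phi\<close>

definition bit_length :: "nat \<Rightarrow> nat" where
  "bit_length r = nat \<lceil>log 2 (1 + real r)\<rceil>"

lemma bit_length_0 [simp]: "bit_length 0 = 0"
  by (simp add: bit_length_def)

text \<open>
  This identifies the logarithmic index in \<open>Phi\<close> as one plus the position of the highest set bit.
\<close>

lemma bit_length_top_bit:
  assumes "r < 2 ^ n"
  shows "bit_length (2 ^ n + r) = Suc n"
proof -
  have "\<lceil>log (real 2) (real (1 + (2 ^ n + r)))\<rceil> = int n + 1"
    using assms by (intro ceiling_log_nat_eq_if) simp_all
  thus ?thesis
    by (simp add: bit_length_def)
qed

definition binary_weight :: "(nat \<Rightarrow> nat \<Rightarrow> complex) \<Rightarrow> nat \<Rightarrow> nat \<Rightarrow> complex" where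
  "binary_weight f n J =
     (\<Prod>k<n. 1 + of_nat (J div 2 ^ k mod 2) * (f (Suc k) (bit_length (J mod 2 ^ k)) - 1))"

lemma Phi_binary: "Phi n f = (\<Sum>J<2 ^ n. binary_weight f n J)"
proof -
  have "Phi n f = (\<Sum>j\<in>Suc ` {..<2 ^ n}. binary_weight f n (j - 1))"
    unfolding Phi_def binary_weight_def beta_def bit_length_def
    by (intro sum.cong) (simp_all add: image_Suc_lessThan)
  thus ?thesis
    by (simp add: sum.reindex)
qed

lemma binary_weight_bit_unset:
  "J < 2 ^ n \<Longrightarrow> binary_weight f (Suc n) J = binary_weight f n J"
  by (simp add: binary_weight_def)

lemma binary_weight_bit_set:
  assumes "J < 2 ^ n"
  shows "binary_weight f (Suc n) (2 ^ n + J) = binary_weight f n J * f (Suc n) (bit_length J)"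
proof -
  have lower_bits: "(2 ^ n + J) div 2 ^ k mod 2 = J div 2 ^ k mod 2 \<and>
      (2 ^ n + J) mod 2 ^ k = J mod 2 ^ k" if "k < n" for k
  proof -
    obtain d where "n = k + Suc d"
      using \<open>k < n\<close> less_iff_Suc_add by auto
    hence "(2::nat) ^ n = (2 * 2 ^ d) * 2 ^ k"
      by (simp add: power_add)
    moreover have "((2 * 2 ^ d) * 2 ^ k + J) div 2 ^ k = 2 * 2 ^ d + J div 2 ^ k"
      by (rule div_mult_self3) simp
    moreover have "((2 * 2 ^ d) * 2 ^ k + J) mod 2 ^ k = J mod 2 ^ k"
      by (rule mod_mult_self3)
    ultimately show ?thesis
      by simp
  qed
  have "binary_weight f (Suc n) (2 ^ n + J) =
      (\<Prod>k<n. 1 + of_nat ((2 ^ n + J) div 2 ^ k mod 2) *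
        (f (Suc k) (bit_length ((2 ^ n + J) mod 2 ^ k)) - 1)) * f (Suc n) (bit_length J)"
    using assms by (simp add: binary_weight_def)
  thus ?thesis
    using lower_bits by (simp add: binary_weight_def)
qed

text \<open>
  The numbers below \<open>2 ^ (n + 1)\<close> are \<open>J\<close> and \<open>2 ^ n + J\<close> with \<open>J < 2 ^ n\<close>: those
  of the second kind have length \<open>n + 1\<close> and gain the factor \<open>f (n + 1) (bit_length J)\<close>.
\<close>

lemma weighted_binary_sum:
  "(\<Sum>J<2 ^ n. binary_weight f n J * g (bit_length J)) = (\<Sum>i\<le>n. g i * path_sum f i)"
proof (rule weighted_path_sum_unique)
  fix g :: "nat \<Rightarrow> complex"
  show "(\<Sum>J<2 ^ 0. binary_weight f 0 J * g (bit_length J)) = g 0"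
    by (simp add: binary_weight_def)
next
  fix n and g :: "nat \<Rightarrow> complex"
  let ?h = "\<lambda>J. binary_weight f (Suc n) J * g (bit_length J)"
  have "(\<Sum>J<2 ^ Suc n. ?h J) = (\<Sum>J<2 ^ n. ?h J) + (\<Sum>J=2 ^ n..<2 ^ n + 2 ^ n. ?h J)"
    by (simp add: lessThan_atLeast0 sum.atLeastLessThan_concat mult_2)
  also have "(\<Sum>J=2 ^ n..<2 ^ n + 2 ^ n. ?h J) = (\<Sum>J<2 ^ n. ?h (2 ^ n + J))"
    using sum.shift_bounds_nat_ivl [of ?h 0 "2 ^ n" "2 ^ n"]
    by (simp add: lessThan_atLeast0 add.commute)
  finally show "(\<Sum>J<2 ^ Suc n. ?h J) =
      (\<Sum>J<2 ^ n. binary_weight f n J * g (bit_length J)) +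
      g (Suc n) * (\<Sum>J<2 ^ n. binary_weight f n J * f (Suc n) (bit_length J))"
    by (simp add: binary_weight_bit_unset binary_weight_bit_set bit_length_top_bit
        sum_distrib_left mult_ac)
qed

lemma Phi_eq_path_sum: "Phi n f = (\<Sum>i\<le>n. path_sum f i)"
  using weighted_binary_sum [of f n "\<lambda>_. 1"] by (simp add: Phi_binary)

section \<open>Expansion over increasing tuples\<close>

definition increasing_lists :: "nat \<Rightarrow> nat list set" where
  "increasing_lists n = {ks. sorted_wrt (<) ks \<and> set ks \<subseteq> {1..n}}"

text \<open>
  Prepending 0 supplies the second argument of the first factor, so that the empty tuple and the
  first entry require no separate treatment.
\<close>

definition chain_weight :: "(nat \<Rightarrow> nat \<Rightarrow> 'a::comm_ring_1) \<Rightarrow> nat list \<Rightarrow> 'a" where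
  "chain_weight f ks = (\<Prod>i<length ks. f (ks ! i) ((0 # ks) ! i))"

lemma chain_weight_snoc:
  "chain_weight f (ks @ [k]) = chain_weight f ks * f k (last (0 # ks))"
proof -
  have "(0 # ks @ [k]) ! length ks = last (0 # ks)"
    by (metis append_Cons last_conv_nth length_Cons diff_Suc_1 lessI list.discI nth_append)
  moreover have "(0 # ks @ [k]) ! i = (0 # ks) ! i" if "i < length ks" for i
    using that by (metis append_Cons length_Cons less_SucI nth_append)
  ultimately show ?thesis
    by (simp add: chain_weight_def nth_append)
qed

lemma chain_weight_nonempty:
  assumes "length ks = m" "m \<ge> 1"
  shows "chain_weight f ks = f (ks ! 0) 0 * (\<Prod>i = 2..m. f (ks ! (i - 1)) (ks ! (i - 2)))"
proof -
  obtain d where d: "m = Suc d"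
    using assms by (cases m) auto
  have "chain_weight f ks = f (ks ! 0) 0 * (\<Prod>i<d. f (ks ! Suc i) (ks ! i))"
    using assms d by (simp add: chain_weight_def prod.lessThan_Suc_shift del: prod.lessThan_Suc)
  also have "(\<Prod>i<d. f (ks ! Suc i) (ks ! i)) =
      (\<Prod>i = 2..m. f (ks ! (i - 1)) (ks ! (i - 2)))"
    by (rule prod.reindex_bij_witness [of _ "\<lambda>i. i - 2" "\<lambda>i. i + 2"]) (auto simp: d)
  finally show ?thesis .
qed

lemma increasing_lists_0: "increasing_lists 0 = {[]}"
  by (auto simp: increasing_lists_def)

lemma increasing_lists_Suc:
  "increasing_lists (Suc n) =
     increasing_lists n \<union> (\<lambda>ks. ks @ [Suc n]) ` increasing_lists n"
proof (intro equalityI subsetI)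
  fix ks
  assume "ks \<in> increasing_lists (Suc n)"
  hence sorted: "sorted_wrt (<) ks" and range: "set ks \<subseteq> {1..Suc n}"
    by (simp_all add: increasing_lists_def)
  show "ks \<in> increasing_lists n \<union> (\<lambda>ks. ks @ [Suc n]) ` increasing_lists n"
  proof (cases "Suc n \<in> set ks")
    case False
    hence "set ks \<subseteq> {1..n}"
      using range by (auto simp: atLeastAtMostSuc_conv)
    thus ?thesis
      using sorted by (simp add: increasing_lists_def)
  next
    case True
    then obtain xs ys where split: "ks = xs @ Suc n # ys"
      by (meson split_list)
    have "ys = []"
      using sorted range by (cases ys) (auto simp: split sorted_wrt_append)
    moreover have "xs \<in> increasing_lists n"
      using sorted range by (fastforce simp: split sorted_wrt_append increasing_lists_def)
    ultimately show ?thesis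
      by (simp add: split)
  qed
next
  fix ks
  assume "ks \<in> increasing_lists n \<union> (\<lambda>ks. ks @ [Suc n]) ` increasing_lists n"
  thus "ks \<in> increasing_lists (Suc n)"
    by (fastforce simp: increasing_lists_def sorted_wrt_append)
qed

lemma finite_increasing_lists: "finite (increasing_lists n)"
  by (induction n) (simp_all add: increasing_lists_0 increasing_lists_Suc)

text \<open>
  Appending \<open>n + 1\<close> to a list plays the part that setting the bit \<open>n\<close> plays in
  \<open>weighted_binary_sum\<close>.
\<close>

lemma weighted_chain_sum:
  fixes f :: "nat \<Rightarrow> nat \<Rightarrow> 'a::comm_ring_1"
  shows "(\<Sum>ks\<in>increasing_lists n. chain_weight f ks * g (last (0 # ks))) =
    (\<Sum>i\<le>n. g i * path_sum f i)"
proof (rule weighted_path_sum_unique)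
  fix g :: "nat \<Rightarrow> 'a"
  show "(\<Sum>ks\<in>increasing_lists 0. chain_weight f ks * g (last (0 # ks))) = g 0"
    by (simp add: increasing_lists_0 chain_weight_def)
next
  fix n and g :: "nat \<Rightarrow> 'a"
  let ?h = "\<lambda>ks. chain_weight f ks * g (last (0 # ks))"
  have disjoint: "increasing_lists n \<inter> (\<lambda>ks. ks @ [Suc n]) ` increasing_lists n = {}"
    by (auto simp: increasing_lists_def)
  have "(\<Sum>ks\<in>increasing_lists (Suc n). ?h ks) =
      (\<Sum>ks\<in>increasing_lists n. ?h ks) + (\<Sum>ks\<in>increasing_lists n. ?h (ks @ [Suc n]))"
    unfolding increasing_lists_Suc
    by (subst sum.union_disjoint) (simp_all add: finite_increasing_lists disjoint sum.reindex inj_on_def)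
  thus "(\<Sum>ks\<in>increasing_lists (Suc n). ?h ks) =
      (\<Sum>ks\<in>increasing_lists n. ?h ks) +
      g (Suc n) * (\<Sum>ks\<in>increasing_lists n. chain_weight f ks * f (Suc n) (last (0 # ks)))"
    by (simp add: chain_weight_snoc sum_distrib_left mult_ac)
qed

lemma sum_increasing_lists_by_length:
  fixes h :: "nat list \<Rightarrow> 'a::comm_monoid_add"
  shows "(\<Sum>ks\<in>increasing_lists n. h ks) = (\<Sum>m\<le>n. \<Sum>ks\<in>increasing_tuples m n. h ks)"
proof -
  have "length ks \<le> n" if "ks \<in> increasing_lists n" for ks
  proof -
    have "distinct ks" "set ks \<subseteq> {1..n}"
      using that by (auto simp: increasing_lists_def strict_sorted_iff)
    thus ?thesis
      using card_mono [of "{1..n}" "set ks"] by (simp add: distinct_card)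
  qed
  hence "length ` increasing_lists n \<subseteq> {..n}"
    by auto
  moreover have "increasing_tuples m n = {ks \<in> increasing_lists n. length ks = m}" for m
    by (auto simp: increasing_tuples_def increasing_lists_def)
  ultimately show ?thesis
    using sum.group [of "increasing_lists n" "{..n}" length h]
    by (simp add: finite_increasing_lists)
qed

lemma Phi_expansion:
  "Phi n f = 1 + (\<Sum>m = 1..n. \<Sum>ks\<in>increasing_tuples m n.
     f (ks ! 0) 0 * (\<Prod>i = 2..m. f (ks ! (i - 1)) (ks ! (i - 2))))"
proof -
  have empty_tuple: "increasing_tuples 0 n = {[]}"
    by (auto simp: increasing_tuples_def)
  have "Phi n f = (\<Sum>ks\<in>increasing_lists n. chain_weight f ks)"
    using weighted_chain_sum [of f "\<lambda>_. 1" n] by (simp add: Phi_eq_path_sum)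
  also have "\<dots> = (\<Sum>m\<le>n. \<Sum>ks\<in>increasing_tuples m n. chain_weight f ks)"
    by (rule sum_increasing_lists_by_length)
  also have "\<dots> = 1 + (\<Sum>m = 1..n. \<Sum>ks\<in>increasing_tuples m n. chain_weight f ks)"
    by (simp add: atMost_atLeast0 sum.atLeast_Suc_atMost empty_tuple chain_weight_def)
  also have "(\<Sum>m = 1..n. \<Sum>ks\<in>increasing_tuples m n. chain_weight f ks) =
      (\<Sum>m = 1..n. \<Sum>ks\<in>increasing_tuples m n.
        f (ks ! 0) 0 * (\<Prod>i = 2..m. f (ks ! (i - 1)) (ks ! (i - 2))))"
    by (intro sum.cong refl chain_weight_nonempty) (auto simp: increasing_tuples_def)
  finally show ?thesis .
qed

section \<open>Superposition for the inhomogeneous recursion\<close>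

lemma sum_triangle_swap:
  fixes G :: "nat \<Rightarrow> nat \<Rightarrow> 'a::comm_monoid_add"
  shows "(\<Sum>k<n. \<Sum>l\<le>k. G l (k - l)) = (\<Sum>l<n. \<Sum>i<n - l. G l i)"
proof -
  have "(\<Sum>k<n. \<Sum>l\<le>k. G l (k - l)) = (\<Sum>(l, i)\<in>{(l, i). l + i < n}. G l i)"
    by (rule sum.triangle_reindex [symmetric])
  also have "{(l, i). l + i < n} = Sigma {..<n} (\<lambda>l. {..<n - l})"
    by auto
  finally show ?thesis
    by (simp add: sum.Sigma)
qed

text \<open>
  The initial value is treated like every other inhomogeneity: the case \<open>n = 0\<close> of the
  recursion reads \<open>w 0 = c 0\<close>. The summand for \<open>l\<close> is the response to \<open>c l\<close> alone.
\<close>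

lemma superposition:
  fixes w c :: "nat \<Rightarrow> 'a::comm_ring_1"
  assumes rec: "\<And>n. w n = c n + (\<Sum>j<n. a n j * w j)"
  shows "w n = (\<Sum>l\<le>n. c l * path_sum (\<lambda>x y. a (x + l) (y + l)) (n - l))"
proof (induction n rule: less_induct)
  case (less n)
  let ?p = "\<lambda>l. path_sum (\<lambda>x y. a (x + l) (y + l))"
  (* Feeding the earlier responses to c l into the recursion for n gives its response at n. *)
  have restart: "(\<Sum>i<n - l. a n (i + l) * ?p l i) = ?p l (n - l)" if "l < n" for l
  proof -
    obtain d where n: "n = Suc d + l"
      using less_imp_Suc_add [OF \<open>l < n\<close>] by (auto simp: add.commute)
    have "n - l = Suc d"
      unfolding n by (rule add_diff_cancel_right')
    thus ?thesis
      by (simp only: path_sum.simps lessThan_Suc_atMost n)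
  qed
  have "(\<Sum>j<n. a n j * w j) = (\<Sum>j<n. a n j * (\<Sum>l\<le>j. c l * ?p l (j - l)))"
    using less by simp
  also have "\<dots> = (\<Sum>j<n. \<Sum>l\<le>j. c l * (a n ((j - l) + l) * ?p l (j - l)))"
    by (simp add: sum_distrib_left mult_ac)
  also have "\<dots> = (\<Sum>l<n. \<Sum>i<n - l. c l * (a n (i + l) * ?p l i))"
    by (rule sum_triangle_swap)
  also have "\<dots> = (\<Sum>l<n. c l * ?p l (n - l))"
    by (simp add: sum_distrib_left [symmetric] restart)
  finally show ?case
    by (subst rec) (simp add: lessThan_Suc_atMost [symmetric])
qed

lemma sum_superposition:
  assumes "\<And>n. w n = c n + (\<Sum>j<n. a n j * w j)"
  shows "(\<Sum>j\<le>n. w j) = (\<Sum>l\<le>n. c l * Phi (n - l) (\<lambda>x y. a (x + l) (y + l)))"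
proof -
  let ?p = "\<lambda>l. path_sum (\<lambda>x y. a (x + l) (y + l))"
  have "(\<Sum>j\<le>n. w j) = (\<Sum>j<Suc n. \<Sum>l\<le>j. c l * ?p l (j - l))"
    unfolding lessThan_Suc_atMost by (intro sum.cong refl superposition assms)
  also have "\<dots> = (\<Sum>l<Suc n. \<Sum>i<Suc n - l. c l * ?p l i)"
    by (rule sum_triangle_swap)
  also have "\<dots> = (\<Sum>l\<le>n. c l * (\<Sum>i\<le>n - l. ?p l i))"
    unfolding lessThan_Suc_atMost
    by (intro sum.cong refl) (simp add: Suc_diff_le lessThan_Suc_atMost sum_distrib_left del: sum.lessThan_Suc)
  finally show ?thesis
    by (simp add: Phi_eq_path_sum)
qed

theorem proposition1:
  fixes w0 :: complex and c :: "nat \<Rightarrow> complex" and a :: "nat \<Rightarrow> nat \<Rightarrow> complex"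
    and w :: "nat \<Rightarrow> complex"
  assumes w_init: "w 0 = w0"
    and w_rec: "\<And>n. n \<ge> 1 \<Longrightarrow> w n = c n + (\<Sum>j = 0..n - 1. a n j * w j)"
  shows "(\<forall>n\<ge>1. \<forall>f :: nat \<Rightarrow> nat \<Rightarrow> complex.
            Phi n f = 1 + (\<Sum>m = 1..n. \<Sum>ks\<in>increasing_tuples m n.
              f (ks ! 0) 0 * (\<Prod>i = 2..m. f (ks ! (i - 1)) (ks ! (i - 2))))) \<and>
         (\<forall>n\<ge>1.
            (\<Sum>j = 0..n. w j) = c n + w0 * Phi n a
              + (\<Sum>l = 1..n - 1. c l * Phi (n - l) (\<lambda>x y. a (x + l) (y + l))))"
proof (intro conjI allI impI)
  fix n :: nat and f :: "nat \<Rightarrow> nat \<Rightarrow> complex"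
  show "Phi n f = 1 + (\<Sum>m = 1..n. \<Sum>ks\<in>increasing_tuples m n.
      f (ks ! 0) 0 * (\<Prod>i = 2..m. f (ks ! (i - 1)) (ks ! (i - 2))))"
    by (rule Phi_expansion)
next
  fix n :: nat
  assume "n \<ge> 1"
  then obtain d where n: "n = Suc d"
    by (cases n) auto
  (* The initial value becomes the inhomogeneity at index 0. *)
  define c' where "c' = c(0 := w0)"
  let ?t = "\<lambda>l. c' l * Phi (n - l) (\<lambda>x y. a (x + l) (y + l))"
  have rec: "w k = c' k + (\<Sum>j<k. a k j * w j)" for k
  proof (cases k)
    case 0
    thus ?thesis
      by (simp add: c'_def w_init)
  next
    case (Suc m)
    thus ?thesis
      using w_rec [of k] by (simp add: c'_def atLeast0AtMost lessThan_Suc_atMost)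
  qed
  have "(\<Sum>j = 0..n. w j) = (\<Sum>l\<le>n. ?t l)"
    unfolding atLeast0AtMost using rec by (rule sum_superposition)
  also have "\<dots> = ?t n + (\<Sum>l\<le>d. ?t l)"
    by (simp add: n add.commute)
  also have "(\<Sum>l\<le>d. ?t l) = ?t 0 + (\<Sum>l = 1..d. ?t l)"
    by (simp add: atMost_atLeast0 sum.atLeast_Suc_atMost)
  also have "?t n = c n"
    by (simp add: c'_def n Phi_eq_path_sum)
  also have "?t 0 = w0 * Phi n a"
    by (simp add: c'_def)
  also have "(\<Sum>l = 1..d. ?t l) =
      (\<Sum>l = 1..n - 1. c l * Phi (n - l) (\<lambda>x y. a (x + l) (y + l)))"
    by (intro sum.cong) (auto simp: c'_def n)
  finally show "(\<Sum>j = 0..n. w j) = c n + w0 * Phi n a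
      + (\<Sum>l = 1..n - 1. c l * Phi (n - l) (\<lambda>x y. a (x + l) (y + l)))"
    by (simp only: add.assoc)
qed

end
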